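(* Let $k$ be a finite field with $q$ elements, let $(W,A)$ be a non-degenerate symplectic space over $k$ of even dimension $2m$, let $G=Sp(A)$, and let $\psi$ be a non-trivial character of the additive group of $k$. With the $G$-vector bundle $(E,p,B,\tau)$ and the family $\Gamma=(\gamma_{L',L})_{L',L\in B}$ defined in the context, $\Gamma$ is a $G$-equivariant connection on $(E,p,B,\tau)$, and its multiplier $\mu$ is given by $$\mu(L'',L',L)=|L''\cap L'|^{1/2}\,\bigl(|L\cap L''|\,|L'\cap L|\,|L|\bigr)^{-1/2}\,\mathcal S_L(L',L'')$$ for all $L,L',L''\in B$.
   Context: $A:W\times W\to k$ is a non-degenerate alternating bilinear form and $Sp(A)$ is its isometry group. A Lagrangian subspace is a maximal totally isotropic subspace. $|X|$ is the cardinality of a finite set $X$. The bundle: $B$ is the set of Lagrangian subspaces of $W$. For $L\in B$, $E_L$ is the complex vector space of all functions $f:W\to\mathbb C$ such that $f(x+y)=\psi(A(x,y))f(x)$ for all $x\in W$, $y\in L$. $E$ is the disjoint union of the $E_L$, and $p:E\to B$ sends $f\in E_L$ to $L$. The group $G$ acts by $\tau_g(L)=g(L)$ on $B$ and by $(\tau_g f)(x)=f(g^{-1}x)$ on $E$. The family $\Gamma$: for $L,L'\in B$, $\gamma_{L',L}:E_L\to E_{L'}$ is defined by $$(\gamma_{L',L}f)(\omega)=\bigl(|L|\,|L\cap L'|\bigr)^{-1/2}\sum_{\zeta\in L'}\psi(-A(\omega,\zeta))\,f(\omega+\zeta)\qquad(\omega\in W).$$ Geometric Gauss sum: $$\mathcal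 S_L(L',L'')=\sum_{\zeta\in L\cap(L'+L'')}\psi(A(\zeta',\zeta'')),$$ where $\zeta=\zeta'+\zeta''$ with $\zeta'\in L'$, $\zeta''\in L''$ (the value $A(\zeta',\zeta'')$ does not depend on the chosen decomposition). Terminology: a connection on $(E,p,B)$ is a family of linear isomorphisms $\gamma_{L',L}:E_L\to E_{L'}$ ($L,L'\in B$) such that $\gamma_{L,L}=\mathrm{Id}$, $\gamma_{L,L'}\circ\gamma_{L',L}=\mathrm{Id}_{E_L}$, and $\gamma_{L'',L'}\circ\gamma_{L',L}=\mu(L'',L',L)\,\gamma_{L'',L}$ for scalars $\mu(L'',L',L)\in\mathbb C^\times$; the function $\mu$ is its multiplier. It is $G$-equivariant if $\tau_g\circ\gamma_{L',L}=\gamma_{gL',gL}\circ\tau_g$ on $E_L$ for all $g\in G$ and $L,L'\in B$.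
   Formalization: The formal theorem assumes in addition that k has odd characteristic (2 ≠ 0 in k); in characteristic 2 with m ≥ 1 the claim fails, since for transversal L, L' the composite of γ_{L',L} and γ_{L,L'} is not the identity. *)

theory Defs
  imports Complex_Main "HOL-Library.Set_Algebras"
begin

locale symplectic_space = finite_dimensional_vector_space scale Basis
  for scale :: "'k::field \<Rightarrow> 'w::ab_group_add \<Rightarrow> 'w" and Basis :: "'w set" +
  fixes A :: "'w \<Rightarrow> 'w \<Rightarrow> 'k"
  assumes linear_left: "Vector_Spaces.linear scale (*) (\<lambda>x. A x y)"
    and linear_right: "Vector_Spaces.linear scale (*) (\<lambda>y. A x y)"
    and alternating: "A x x = 0"
    and nondegenerate: "(\<forall>y. A x y = 0) \<Longrightarrow> x = 0"

definition Sp :: "('k::field \<Rightarrow> 'w::ab_group_add \<Rightarrow> 'w) \<Rightarrow> ('w \<Rightarrow> 'w \<Rightarrow> 'k) \<Rightarrow> ('w \<Rightarrow> 'w) set" where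
  "Sp scale A = {g. Vector_Spaces.linear scale scale g \<and> bij g \<and> (\<forall>x y. A (g x) (g y) = A x y)}"

definition totally_isotropic ::
  "('k::field \<Rightarrow> 'w::ab_group_add \<Rightarrow> 'w) \<Rightarrow> ('w \<Rightarrow> 'w \<Rightarrow> 'k) \<Rightarrow> 'w set \<Rightarrow> bool" where
  "totally_isotropic scale A L \<longleftrightarrow> module.subspace scale L \<and> (\<forall>x\<in>L. \<forall>y\<in>L. A x y = 0)"

definition Lagrangians ::
  "('k::field \<Rightarrow> 'w::ab_group_add \<Rightarrow> 'w) \<Rightarrow> ('w \<Rightarrow> 'w \<Rightarrow> 'k) \<Rightarrow> 'w set set" where
  "Lagrangians scale A =
     {L. totally_isotropic scale A L \<and> (\<forall>M. totally_isotropic scale A M \<longrightarrow> L \<subseteq> M \<longrightarrow> M = L)}"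

definition additive_character :: "('k::field \<Rightarrow> complex) \<Rightarrow> bool" where
  "additive_character \<psi> \<longleftrightarrow> (\<forall>a. \<psi> a \<noteq> 0) \<and> (\<forall>a b. \<psi> (a + b) = \<psi> a * \<psi> b)"

definition nontrivial_character :: "('k::field \<Rightarrow> complex) \<Rightarrow> bool" where
  "nontrivial_character \<psi> \<longleftrightarrow> additive_character \<psi> \<and> (\<exists>a. \<psi> a \<noteq> 1)"

text \<open>
  A bundle over \<open>B\<close> is given by its fibres \<open>E L\<close>, \<open>L \<in> B\<close>, which are complex vector spaces of
  functions under the pointwise operations. The total space is the disjoint union
  \<open>Sigma B E\<close>, with projection \<open>fst\<close>. The map \<open>\<gamma>\<^bsub>L',L\<^esub>\<close> is written \<open>\<gamma> L' L\<close>; only its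
  values on \<open>E L\<close> matter.
\<close>

definition linear_iso_on ::
  "('x \<Rightarrow> complex) set \<Rightarrow> ('x \<Rightarrow> complex) set \<Rightarrow> (('x \<Rightarrow> complex) \<Rightarrow> ('x \<Rightarrow> complex)) \<Rightarrow> bool" where
  "linear_iso_on V V' T \<longleftrightarrow>
     bij_betw T V V' \<and>
     (\<forall>f\<in>V. \<forall>h\<in>V. T (\<lambda>x. f x + h x) = (\<lambda>x. T f x + T h x)) \<and>
     (\<forall>c. \<forall>f\<in>V. T (\<lambda>x. c * f x) = (\<lambda>x. c * T f x))"

definition is_multiplier ::
  "'b set \<Rightarrow> ('b \<Rightarrow> ('x \<Rightarrow> complex) set) \<Rightarrow> ('b \<Rightarrow> 'b \<Rightarrow> ('x \<Rightarrow> complex) \<Rightarrow> ('x \<Rightarrow> complex))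
     \<Rightarrow> ('b \<Rightarrow> 'b \<Rightarrow> 'b \<Rightarrow> complex) \<Rightarrow> bool" where
  "is_multiplier B E \<gamma> \<mu> \<longleftrightarrow>
     (\<forall>L\<in>B. \<forall>L'\<in>B. \<forall>L''\<in>B. \<mu> L'' L' L \<noteq> 0 \<and>
        (\<forall>f\<in>E L. \<gamma> L'' L' (\<gamma> L' L f) = (\<lambda>x. \<mu> L'' L' L * \<gamma> L'' L f x)))"

definition is_connection ::
  "'b set \<Rightarrow> ('b \<Rightarrow> ('x \<Rightarrow> complex) set) \<Rightarrow> ('b \<Rightarrow> 'b \<Rightarrow> ('x \<Rightarrow> complex) \<Rightarrow> ('x \<Rightarrow> complex))
     \<Rightarrow> bool" where
  "is_connection B E \<gamma> \<longleftrightarrow>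
     (\<forall>L\<in>B. \<forall>L'\<in>B. linear_iso_on (E L) (E L') (\<gamma> L' L)) \<and>
     (\<forall>L\<in>B. \<forall>f\<in>E L. \<gamma> L L f = f) \<and>
     (\<forall>L\<in>B. \<forall>L'\<in>B. \<forall>f\<in>E L. \<gamma> L L' (\<gamma> L' L f) = f) \<and>
     (\<exists>\<mu>. is_multiplier B E \<gamma> \<mu>)"

definition is_equivariant ::
  "'g set \<Rightarrow> ('g \<Rightarrow> 'b \<Rightarrow> 'b) \<Rightarrow> ('g \<Rightarrow> ('x \<Rightarrow> complex) \<Rightarrow> ('x \<Rightarrow> complex)) \<Rightarrow> 'b set
     \<Rightarrow> ('b \<Rightarrow> ('x \<Rightarrow> complex) set) \<Rightarrow> ('b \<Rightarrow> 'b \<Rightarrow> ('x \<Rightarrow> complex) \<Rightarrow> ('x \<Rightarrow> complex)) \<Rightarrow> bool" where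
  "is_equivariant G \<tau>B \<tau>E B E \<gamma> \<longleftrightarrow>
     (\<forall>g\<in>G. \<forall>L\<in>B. \<forall>L'\<in>B. \<forall>f\<in>E L. \<tau>E g (\<gamma> L' L f) = \<gamma> (\<tau>B g L') (\<tau>B g L) (\<tau>E g f))"

definition fibre ::
  "('w::ab_group_add \<Rightarrow> 'w \<Rightarrow> 'k::field) \<Rightarrow> ('k \<Rightarrow> complex) \<Rightarrow> 'w set \<Rightarrow> ('w \<Rightarrow> complex) set" where
  "fibre A \<psi> L = {f. \<forall>x. \<forall>y\<in>L. f (x + y) = \<psi> (A x y) * f x}"

definition tau_base :: "('w \<Rightarrow> 'w) \<Rightarrow> 'w set \<Rightarrow> 'w set" where
  "tau_base g L = g ` L"

definition tau_fun :: "('w \<Rightarrow> 'w) \<Rightarrow> ('w \<Rightarrow> complex) \<Rightarrow> ('w \<Rightarrow> complex)" where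
  "tau_fun g f = (\<lambda>x. f (inv g x))"

definition Gamma ::
  "('w::ab_group_add \<Rightarrow> 'w \<Rightarrow> 'k::field) \<Rightarrow> ('k \<Rightarrow> complex) \<Rightarrow> 'w set \<Rightarrow> 'w set
     \<Rightarrow> ('w \<Rightarrow> complex) \<Rightarrow> ('w \<Rightarrow> complex)" where
  "Gamma A \<psi> L' L f = (\<lambda>\<omega>.
     complex_of_real ((real (card L) * real (card (L \<inter> L'))) powr (- 1 / 2)) *
     (\<Sum>\<zeta>\<in>L'. \<psi> (- A \<omega> \<zeta>) * f (\<omega> + \<zeta>)))"

text \<open>In \<open>gauss_sum\<close> the set \<open>L' + L''\<close> is the elementwise sum. The decomposition
  \<open>\<zeta> = \<zeta>' + \<zeta>''\<close> is chosen arbitrarily; see \<open>gauss_term_well_defined\<close> below.\<close>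

definition gauss_sum ::
  "('w::ab_group_add \<Rightarrow> 'w \<Rightarrow> 'k::field) \<Rightarrow> ('k \<Rightarrow> complex) \<Rightarrow> 'w set \<Rightarrow> 'w set \<Rightarrow> 'w set
     \<Rightarrow> complex" where
  "gauss_sum A \<psi> L L' L'' =
     (\<Sum>\<zeta>\<in>L \<inter> (L' + L'').
        let (\<zeta>', \<zeta>'') = (SOME (a, b). a \<in> L' \<and> b \<in> L'' \<and> \<zeta> = a + b) in \<psi> (A \<zeta>' \<zeta>''))"

context symplectic_space
begin

lemma A_add_left: "A (x + y) z = A x z + A y z"
  and A_diff_left: "A (x - y) z = A x z - A y z"
proof -
  interpret Vector_Spaces.linear scale "(*)" "\<lambda>x. A x z" by (rule linear_left)
  show "A (x + y) z = A x z + A y z" "A (x - y) z = A x z - A y z" by (rule add diff)+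
qed

lemma A_add_right: "A z (x + y) = A z x + A z y"
  and A_diff_right: "A z (x - y) = A z x - A z y"
proof -
  interpret Vector_Spaces.linear scale "(*)" "\<lambda>x. A z x" by (rule linear_right)
  show "A z (x + y) = A z x + A z y" "A z (x - y) = A z x - A z y" by (rule add diff)+
qed

lemma gauss_term_well_defined:
  assumes "totally_isotropic scale A L'" "totally_isotropic scale A L''"
    and "a \<in> L'" "c \<in> L'" "b \<in> L''" "d \<in> L''" "a + b = c + d"
  shows "A a b = A c d"
proof -
  have e: "a - c = d - b" using assms(7) by (simp add: algebra_simps)
  have sub: "module.subspace scale L'" "module.subspace scale L''"
    using assms unfolding totally_isotropic_def by auto
  have m: "a - c \<in> L'" "d - b \<in> L''" using sub assms subspace_diff by auto
  have "A (a - c) b = 0" "A c (d - b) = 0"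
    using m assms e unfolding totally_isotropic_def by metis+
  then show ?thesis by (simp add: A_diff_left A_diff_right)
qed

lemma fibre_is_subspace:
  "(\<lambda>x. 0) \<in> fibre A \<psi> L"
  "f \<in> fibre A \<psi> L \<Longrightarrow> h \<in> fibre A \<psi> L \<Longrightarrow> (\<lambda>x. f x + h x) \<in> fibre A \<psi> L"
  "f \<in> fibre A \<psi> L \<Longrightarrow> (\<lambda>x. c * f x) \<in> fibre A \<psi> L"
  by (auto simp: fibre_def algebra_simps)

lemma Sp_inv:
  assumes g: "g \<in> Sp scale A"
  shows "inv g \<in> Sp scale A"
proof -
  have b: "bij g" and l: "Vector_Spaces.linear scale scale g" and i: "\<And>x y. A (g x) (g y) = A x y"
    using g by (auto simp: Sp_def)
  interpret g: Vector_Spaces.linear scale scale g by (rule l)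
  have s: "g (inv g x) = x" for x using b by (simp add: bij_is_surj surj_f_inv_f)
  have "inj g" using b by (rule bij_is_inj)
  have "Vector_Spaces.linear scale scale (inv g)"
  proof unfold_locales
    show "inv g (x + y) = inv g x + inv g y" for x y
      by (rule injD[OF \<open>inj g\<close>]) (simp add: s g.add)
    show "inv g (scale r x) = scale r (inv g x)" for r x
      by (rule injD[OF \<open>inj g\<close>]) (simp add: s g.scale)
  qed
  moreover have "A (inv g x) (inv g y) = A x y" for x y
    by (metis i s)
  ultimately show ?thesis using b by (simp add: Sp_def bij_imp_bij_inv)
qed

lemma tau_base_totally_isotropic:
  assumes g: "g \<in> Sp scale A" and L: "totally_isotropic scale A L"
  shows "totally_isotropic scale A (tau_base g L)"
proof -
  interpret g: Vector_Spaces.linear scale scale g using g by (simp add: Sp_def)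
  show ?thesis
    using g L by (auto simp: totally_isotropic_def tau_base_def Sp_def g.subspace_image)
qed

lemma tau_base_Lagrangian:
  assumes g: "g \<in> Sp scale A" and L: "L \<in> Lagrangians scale A"
  shows "tau_base g L \<in> Lagrangians scale A"
proof -
  have b: "bij g" using g by (simp add: Sp_def)
  have "M = tau_base g L" if M: "totally_isotropic scale A M" and sub: "tau_base g L \<subseteq> M" for M
  proof -
    have "totally_isotropic scale A (tau_base (inv g) M)"
      using tau_base_totally_isotropic[OF Sp_inv[OF g] M] .
    moreover have "L \<subseteq> tau_base (inv g) M"
      using sub b by (force simp: tau_base_def bij_is_inj)
    ultimately have "tau_base (inv g) M = L" using L by (auto simp: Lagrangians_def)
    then show ?thesis using b by (auto simp: tau_base_def image_comp bij_is_surj surj_f_inv_f)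
  qed
  then show ?thesis
    using L tau_base_totally_isotropic[OF g] by (auto simp: Lagrangians_def)
qed

lemma tau_fun_fibre:
  assumes g: "g \<in> Sp scale A" and f: "f \<in> fibre A \<psi> L"
  shows "tau_fun g f \<in> fibre A \<psi> (tau_base g L)"
proof -
  have "f (inv g (x + g y)) = \<psi> (A x (g y)) * f (inv g x)" if "y \<in> L" for x y
  proof -
    interpret h: Vector_Spaces.linear scale scale "inv g"
      using Sp_inv[OF g] by (simp add: Sp_def)
    have b: "bij g" and i: "A (g x) (g y) = A x y" for x y using g by (auto simp: Sp_def)
    have "inv g (g y) = y" using b by (simp add: bij_is_inj)
    moreover have "A x (g y) = A (inv g x) y"
      using i[of "inv g x" y] b by (simp add: bij_is_surj surj_f_inv_f)
    ultimately show ?thesis using f that by (simp add: fibre_def h.add)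
  qed
  then show ?thesis by (auto simp: fibre_def tau_fun_def tau_base_def)
qed

end

end

theory Submission
  imports Defs "HOL-Library.FuncSet"
begin

(* For h in the fibre over L'', the composite of the maps from L'' to L, from L to L' and back to
   L'' is evaluated directly: moving the summation variable of L'' out of h leaves a character sum
   over L'', which by orthogonality restricts the two remaining variables v in L', y in L to
   v + y in L''; there h contributes only the factor h w, and what is left is a Gauss sum. With
   L'' = L this shows that the maps are mutually inverse, and hence the general statement follows by
   inserting the image of f for h. Orthogonality also gives card L ^ 2 = card W for Lagrangian L. *)

text \<open>Characteristic 2 is excluded because the composite of three maps leads to a sum of
  \<open>\<psi>\<close> over values \<open>2 * A z u\<close>, to which orthogonality of characters
  is applied.\<close>

locale finite_symplectic_space = symplectic_space scale Basis A
  for scale :: "'k::{field,finite} \<Rightarrow> 'w::ab_group_add \<Rightarrow> 'w"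
    and Basis :: "'w set" and A :: "'w \<Rightarrow> 'w \<Rightarrow> 'k" +
  fixes \<psi> :: "'k \<Rightarrow> complex"
  assumes two_nonzero: "(2 :: 'k) \<noteq> 0"
    and character: "nontrivial_character \<psi>"
begin

section \<open>The character, the form and orthogonality of characters\<close>

lemma psi_add: "\<psi> (a + b) = \<psi> a * \<psi> b"
  using character by (simp add: nontrivial_character_def additive_character_def)

lemma psi_nonzero: "\<psi> a \<noteq> 0"
  using character by (simp add: nontrivial_character_def additive_character_def)

lemma psi_zero [simp]: "\<psi> 0 = 1"
  using psi_add[of 0 0] psi_nonzero[of 0] by simp

lemma A_scale_left: "A (scale r x) y = r * A x y"
proof -
  interpret Vector_Spaces.linear scale "(*)" "\<lambda>x. A x y" by (rule linear_left)
  show ?thesis by (rule scale)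
qed

lemma A_scale_right: "A x (scale r y) = r * A x y"
proof -
  interpret Vector_Spaces.linear scale "(*)" "\<lambda>y. A x y" by (rule linear_right)
  show ?thesis by (rule scale)
qed

lemma A_zero_left [simp]: "A 0 y = 0"
  using A_diff_left[of 0 0 y] by simp

lemma A_minus_left: "A (- x) y = - A x y"
  using A_diff_left[of 0 x y] by simp

lemma A_swap: "A x y = - A y x"
proof -
  have "A (x + y) (x + y) = A x y + A y x"
    by (simp add: A_add_left A_add_right alternating[of x] alternating[of y])
  then show ?thesis
    by (simp add: alternating eq_neg_iff_add_eq_0)
qed

text \<open>Over a finite field, adjoining one vector to a finite spanning set keeps the span
  finite, and a finite basis spans everything.\<close>

lemma finite_space: "finite (UNIV :: 'w set)"
proof -
  have "finite (span S)" if "finite S" for S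
    using that
  proof (induction S rule: finite_induct)
    case (insert x S)
    have "span (insert x S) \<subseteq> (\<lambda>(r, v). v + scale r x) ` (UNIV \<times> span S)"
    proof
      fix v assume "v \<in> span (insert x S)"
      then obtain r where "v - scale r x \<in> span S"
        using span_breakdown_eq by blast
      then show "v \<in> (\<lambda>(r, v). v + scale r x) ` (UNIV \<times> span S)"
        by (intro image_eqI[where x = "(r, v - scale r x)"]) auto
    qed
    then show ?case
      by (rule finite_subset) (simp add: insert.IH)
  qed simp
  then show ?thesis
    using finite_Basis span_Basis by metis
qed

lemma finite_subset_space [simp]: "finite (S :: 'w set)"
  using finite_space by (rule finite_subset[rotated]) simp

text \<open>If \<open>A z\<close> does not vanish on \<open>V\<close>, translation by a suitable
  vector of \<open>V\<close> permutes the summands and multiplies the sum by some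
  \<open>\<psi> a \<noteq> 1\<close>, so the sum is zero. The factor \<open>c\<close> takes the
  values 1, -1 and 2 below.\<close>

lemma sum_character:
  assumes V: "subspace V" and c: "c \<noteq> 0"
  shows "(\<Sum>v\<in>V. \<psi> (c * A z v)) = (if \<forall>v\<in>V. A z v = 0 then of_nat (card V) else 0)"
proof (cases "\<forall>v\<in>V. A z v = 0")
  case False
  then obtain u where u: "u \<in> V" "A z u \<noteq> 0" by blast
  obtain a where a: "\<psi> a \<noteq> 1"
    using character by (auto simp: nontrivial_character_def)
  \<comment> \<open>Scaled so that \<open>c * A z w\<close> is exactly \<open>a\<close>.\<close>
  define w where "w = scale (a / (c * A z u)) u"
  have w: "w \<in> V" "c * A z w = a"
    using u V c by (simp_all add: w_def subspace_scale A_scale_right)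
  have "bij_betw (\<lambda>v. v + w) V V"
    by (rule bij_betwI[where g = "\<lambda>v. v - w"])
      (use V w in \<open>auto intro: subspace_add subspace_diff\<close>)
  from sum.reindex_bij_betw[OF this, of "\<lambda>v. \<psi> (c * A z v)"]
  have "(\<Sum>v\<in>V. \<psi> (c * A z v)) = (\<Sum>v\<in>V. \<psi> (c * A z v) * \<psi> a)"
    by (simp add: A_add_right distrib_left psi_add w)
  also have "\<dots> = (\<Sum>v\<in>V. \<psi> (c * A z v)) * \<psi> a"
    by (simp add: sum_distrib_right)
  finally show ?thesis
    using a False by auto
qed simp

section \<open>Lagrangian subspaces\<close>

abbreviation "Lag \<equiv> Lagrangians scale A"

lemma Lag_isotropic:
  assumes "L \<in> Lag"
  shows "totally_isotropic scale A L"
  using assms by (simp add: Lagrangians_def)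

lemma Lag_subspace:
  assumes "L \<in> Lag"
  shows "subspace L"
  using assms by (simp add: Lagrangians_def totally_isotropic_def)

lemma Lag_A_eq_0:
  assumes "L \<in> Lag" "x \<in> L" "y \<in> L"
  shows "A x y = 0"
  using assms by (simp add: Lagrangians_def totally_isotropic_def)

text \<open>A Lagrangian is its own orthogonal complement: since the form is alternating, adjoining
  a vector orthogonal to \<open>L\<close> keeps the span totally isotropic, so maximality puts that
  vector in \<open>L\<close>.\<close>

lemma Lag_orthogonal_iff:
  assumes L: "L \<in> Lag"
  shows "(\<forall>y\<in>L. A x y = 0) \<longleftrightarrow> x \<in> L"
proof
  assume x: "\<forall>y\<in>L. A x y = 0"
  then have x': "A y x = 0" if "y \<in> L" for y
    using that A_swap[of y x] by simp
  define M where "M = span (insert x L)"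
  have M: "\<exists>r. \<exists>w\<in>L. v = w + scale r x" if v: "v \<in> M" for v
  proof -
    obtain r where "v - scale r x \<in> span L"
      using v span_breakdown_eq unfolding M_def by blast
    then have "v - scale r x \<in> L"
      using Lag_subspace[OF L] span_eq_iff by metis
    then show ?thesis
      by (intro exI[of _ r] bexI[of _ "v - scale r x"]) auto
  qed
  have "A v w = 0" if "v \<in> M" "w \<in> M" for v w
    using M[OF that(1)] M[OF that(2)] x x' Lag_A_eq_0[OF L]
    by (auto simp: A_add_left A_add_right A_scale_left A_scale_right alternating)
  then have "totally_isotropic scale A M"
    by (simp add: totally_isotropic_def M_def)
  moreover have "insert x L \<subseteq> M"
    unfolding M_def by (rule span_superset)
  ultimately show "x \<in> L"
    using L by (auto simp: Lagrangians_def)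
qed (use Lag_A_eq_0[OF L] in auto)

lemma sum_character_Lag:
  assumes "L \<in> Lag" "c \<noteq> 0"
  shows "(\<Sum>y\<in>L. \<psi> (c * A z y)) = (if z \<in> L then of_nat (card L) else 0)"
  using sum_character[OF Lag_subspace[OF assms(1)] assms(2)] Lag_orthogonal_iff[OF assms(1)]
  by simp

text \<open>The sum of \<open>\<psi> (A w x)\<close> over all \<open>w\<close> and all
  \<open>x \<in> L\<close> is computed in both orders. Summing over \<open>x\<close> first leaves
  \<open>w \<in> L\<close>; summing over \<open>w\<close> first leaves \<open>x = 0\<close> by
  non-degeneracy.\<close>

lemma card_Lag_square:
  assumes L: "L \<in> Lag"
  shows "card L * card L = card (UNIV :: 'w set)"
proof -
  have *: "(\<forall>v. A z v = 0) \<longleftrightarrow> z = 0" for z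
    using nondegenerate by auto
  have "(of_nat (card L * card L) :: complex) = (\<Sum>w\<in>UNIV. \<Sum>x\<in>L. \<psi> (1 * A w x))"
    by (simp only: sum_character_Lag[OF L] one_neq_zero not_False_eq_True)
      (simp add: sum.If_cases)
  \<comment> \<open>Swapping the arguments of the form puts the fixed vector on the left, as
    \<open>sum_character\<close> expects; the sign becomes \<open>c = - 1\<close>.\<close>
  also have "\<dots> = (\<Sum>x\<in>L. \<Sum>w\<in>UNIV. \<psi> (- 1 * A x w))"
    by (subst sum.swap) (intro sum.cong refl, metis A_swap mult_1 mult_minus1)
  also have "\<dots> = (\<Sum>x\<in>L. if x = 0 then of_nat (card (UNIV :: 'w set)) else 0)"
    by (subst sum_character) (auto simp: *)
  also have "\<dots> = of_nat (card (UNIV :: 'w set))"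
    using subspace_0[OF Lag_subspace[OF L]] by simp
  finally show ?thesis
    using of_nat_eq_iff by blast
qed

lemma card_Lag_eq:
  assumes "L \<in> Lag" "L' \<in> Lag"
  shows "card L = card L'"
proof -
  have "(card L)\<^sup>2 = (card L')\<^sup>2"
    by (simp add: power2_eq_square card_Lag_square assms)
  then show ?thesis by simp
qed

lemma card_Lag_Int_pos:
  assumes "L \<in> Lag" "L' \<in> Lag"
  shows "card (L \<inter> L') > 0"
  using assms subspace_0[OF Lag_subspace] by (auto simp: card_gt_0_iff)

section \<open>Gauss sums\<close>

definition gauss_term :: "'w set \<Rightarrow> 'w set \<Rightarrow> 'w \<Rightarrow> complex" where
  "gauss_term L' L'' \<zeta> =
     (let (\<zeta>', \<zeta>'') = (SOME (a, b). a \<in> L' \<and> b \<in> L'' \<and> \<zeta> = a + b) in \<psi> (A \<zeta>' \<zeta>''))"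

lemma gauss_sum_eq: "gauss_sum A \<psi> L L' L'' = (\<Sum>\<zeta>\<in>L \<inter> (L' + L''). gauss_term L' L'' \<zeta>)"
  by (simp add: gauss_sum_def gauss_term_def)

text \<open>The chosen pair is another decomposition of \<open>a + b\<close>, and the value of the
  form does not depend on the decomposition.\<close>

lemma gauss_term_add:
  assumes L: "L' \<in> Lag" "L'' \<in> Lag" and ab: "a \<in> L'" "b \<in> L''"
  shows "gauss_term L' L'' (a + b) = \<psi> (A a b)"
proof -
  define P where "P = (\<lambda>(c, d). c \<in> L' \<and> d \<in> L'' \<and> a + b = c + d)"
  obtain c d where cd: "(SOME p. P p) = (c, d)" by fastforce
  have "P (SOME p. P p)"
    by (rule someI[of P "(a, b)"]) (simp add: P_def ab)
  then have "c \<in> L'" "d \<in> L''" "a + b = c + d"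
    by (simp_all add: cd) (simp_all add: P_def)
  then have "A a b = A c d"
    using gauss_term_well_defined[OF Lag_isotropic[OF L(1)] Lag_isotropic[OF L(2)]] ab by blast
  then show ?thesis
    using cd by (simp add: gauss_term_def P_def)
qed

text \<open>The index set parametrises the decompositions of \<open>y\<close> along
  \<open>L' + L''\<close>. If it is non-empty it is a coset of \<open>L' \<inter> L''\<close>, and
  the summand is constant on it.\<close>

lemma sum_decompositions:
  assumes L: "L' \<in> Lag" "L'' \<in> Lag"
  shows "(\<Sum>v | v \<in> L' \<and> v + y \<in> L''. \<psi> (- A v y)) =
    (if y \<in> L' + L'' then of_nat (card (L' \<inter> L'')) * gauss_term L' L'' y else 0)"
proof (cases "y \<in> L' + L''")
  case True
  note sub = Lag_subspace[OF L(1)] Lag_subspace[OF L(2)]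
  from True obtain a b where ab: "a \<in> L'" "b \<in> L''" "y = a + b"
    by (auto simp: set_plus_def)
  \<comment> \<open>\<open>v = - a\<close> is one solution; any other differs from it by an element
    \<open>d\<close> of \<open>L' \<inter> L''\<close>.\<close>
  have "bij_betw (\<lambda>d. d - a) (L' \<inter> L'') {v \<in> L'. v + y \<in> L''}"
  proof (rule bij_betwI[where g = "\<lambda>v. v + a"])
    show "(\<lambda>d. d - a) \<in> L' \<inter> L'' \<rightarrow> {v \<in> L'. v + y \<in> L''}"
      using sub ab by (auto intro: subspace_add subspace_diff)
    show "(\<lambda>v. v + a) \<in> {v \<in> L'. v + y \<in> L''} \<rightarrow> L' \<inter> L''"
    proof
      fix v assume v: "v \<in> {v \<in> L'. v + y \<in> L''}"
      then have "v + y - b \<in> L''"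
        by (intro subspace_diff[OF sub(2)] ab) simp
      moreover have "v + y - b = v + a"
        by (simp add: ab add.assoc[symmetric])
      ultimately show "v + a \<in> L' \<inter> L''"
        using v sub ab by (auto intro: subspace_add)
    qed
  qed auto
  then have card: "card {v \<in> L'. v + y \<in> L''} = card (L' \<inter> L'')"
    by (simp add: bij_betw_same_card)
  \<comment> \<open>Use the decomposition \<open>y = - v + (v + y)\<close>, for which
    \<open>A (- v) (v + y) = - A v y\<close>.\<close>
  have "\<psi> (- A v y) = gauss_term L' L'' y" if "v \<in> L'" "v + y \<in> L''" for v
    using gauss_term_add[OF L, of "- v" "v + y"] that sub
    by (simp add: subspace_neg A_minus_left A_add_right alternating)
  then show ?thesis
    using True by (simp add: card)
next
  case False
  have "{v. v \<in> L' \<and> v + y \<in> L''} = {}"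
  proof (rule ccontr)
    assume "{v. v \<in> L' \<and> v + y \<in> L''} \<noteq> {}"
    then obtain v where "v \<in> L'" "v + y \<in> L''" by blast
    then have "- v + (v + y) \<in> L' + L''"
      using Lag_subspace[OF L(1)] by (intro set_plus_intro subspace_neg)
    with False show False by simp
  qed
  with False show ?thesis by (simp only: sum.empty if_False)
qed

lemma sum_decompositions_Lag:
  assumes "L' \<in> Lag" "L'' \<in> Lag"
  shows "(\<Sum>y\<in>L. \<Sum>v | v \<in> L' \<and> v + y \<in> L''. \<psi> (- A v y)) =
    of_nat (card (L' \<inter> L'')) * gauss_sum A \<psi> L L' L''"
  by (simp add: sum_decompositions[OF assms] gauss_sum_eq sum_distrib_left sum.inter_restrict
      if_distrib[of "\<lambda>z. _ * z"] cong: if_cong)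

text \<open>Every \<open>y \<in> L\<close> has the decomposition \<open>0 + y\<close>, so each
  summand is 1.\<close>

lemma gauss_sum_same:
  assumes "L \<in> Lag" "L' \<in> Lag"
  shows "gauss_sum A \<psi> L L' L = of_nat (card L)"
proof -
  have "0 \<in> L'"
    using assms by (simp add: Lag_subspace subspace_0)
  then have "L \<inter> (L' + L) = L" "gauss_term L' L y = 1" if "y \<in> L" for y
    using gauss_term_add[of L' L 0 y] assms that by (auto intro: set_zero_plus2[THEN subsetD])
  then show ?thesis
    using subspace_0[OF Lag_subspace[OF assms(1)]] by (auto simp: gauss_sum_eq)
qed

section \<open>The maps between fibres\<close>

lemma fibreD: "f \<in> fibre A \<psi> L \<Longrightarrow> y \<in> L \<Longrightarrow> f (x + y) = \<psi> (A x y) * f x"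
  by (simp add: fibre_def)

text \<open>Substituting \<open>\<zeta> - y\<close> for \<open>\<zeta>\<close> absorbs the shift by
  \<open>y \<in> L'\<close>; since \<open>A\<close> vanishes on \<open>L'\<close>, only the factor
  \<open>\<psi> (A x y)\<close> remains.\<close>

lemma Gamma_fibre:
  assumes L: "L' \<in> Lag"
  shows "Gamma A \<psi> L' L f \<in> fibre A \<psi> L'"
proof -
  have "(\<Sum>\<zeta>\<in>L'. \<psi> (- A (x + y) \<zeta>) * f (x + y + \<zeta>)) =
      \<psi> (A x y) * (\<Sum>\<zeta>\<in>L'. \<psi> (- A x \<zeta>) * f (x + \<zeta>))" if y: "y \<in> L'" for x y
  proof -
    have "bij_betw (\<lambda>\<zeta>. \<zeta> - y) L' L'"
      by (rule bij_betwI[where g = "\<lambda>v. v + y"])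
        (use Lag_subspace[OF L] y in \<open>auto intro: subspace_add subspace_diff\<close>)
    from sum.reindex_bij_betw[OF this, of "\<lambda>\<zeta>. \<psi> (- A (x + y) \<zeta>) * f (x + y + \<zeta>)", symmetric]
    show ?thesis
      using Lag_A_eq_0[OF L y]
      by (simp add: sum_distrib_left A_add_left A_diff_right alternating psi_add[symmetric]
          mult.assoc[symmetric])
  qed
  then show ?thesis
    by (simp add: fibre_def Gamma_def mult.left_commute)
qed

lemma Gamma_add: "Gamma A \<psi> L' L (\<lambda>x. f x + h x) = (\<lambda>x. Gamma A \<psi> L' L f x + Gamma A \<psi> L' L h x)"
  by (simp add: Gamma_def distrib_left sum.distrib)

lemma Gamma_scale: "Gamma A \<psi> L' L (\<lambda>x. c * f x) = (\<lambda>x. c * Gamma A \<psi> L' L f x)"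
  by (simp add: Gamma_def mult.left_commute flip: sum_distrib_left)

text \<open>Every summand equals \<open>f x\<close>, and their number cancels the normalising
  factor.\<close>

lemma Gamma_same:
  assumes L: "L \<in> Lag" and f: "f \<in> fibre A \<psi> L"
  shows "Gamma A \<psi> L L f = f"
proof
  fix x
  have "\<psi> (- A x \<zeta>) * f (x + \<zeta>) = f x" if "\<zeta> \<in> L" for \<zeta>
    using fibreD[OF f that] by (simp add: mult.assoc[symmetric] psi_add[symmetric])
  moreover have "(n * n) powr (- 1 / 2) * n = 1" if "n > 0" for n :: real
    using that by (simp add: powr_minus_divide powr_half_sqrt)
  then have "(real (card L) * real (card L)) powr (- 1 / 2) * real (card L) = 1"
    using card_Lag_Int_pos[OF L L] by (metis Int_absorb of_nat_0_less_iff)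
  then have "complex_of_real ((real (card L) * real (card L)) powr (- 1 / 2)) * of_nat (card L) = 1"
    by (metis of_real_mult of_real_of_nat_eq of_real_1)
  ultimately show "Gamma A \<psi> L L f x = f x"
    by (simp add: Gamma_def mult.assoc[symmetric])
qed

section \<open>Composites of maps and the multiplier\<close>

lemma sum_triple:
  assumes L: "L \<in> Lag" "L' \<in> Lag" "L'' \<in> Lag" and h: "h \<in> fibre A \<psi> L''"
  shows "(\<Sum>u\<in>L''. \<psi> (- A \<omega> u) * (\<Sum>v\<in>L'. \<psi> (- A (\<omega> + u) v) *
      (\<Sum>y\<in>L. \<psi> (- A (\<omega> + u + v) y) * h (\<omega> + u + v + y)))) =
    of_nat (card L'') * of_nat (card (L' \<inter> L'')) * gauss_sum A \<psi> L L' L'' * h \<omega>"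
    (is "?lhs = _")
proof -
  \<comment> \<open>The fibre condition takes \<open>u\<close> out of the argument of
    \<open>h\<close>. The terms \<open>A \<omega> u\<close> cancel, and antisymmetry makes the
    remaining terms in \<open>u\<close> add up to \<open>2 * A (v + y) u\<close>.\<close>
  have move: "\<psi> (- A \<omega> u) * (\<psi> (- A (\<omega> + u) v) * (\<psi> (- A (\<omega> + u + v) y) * h (\<omega> + u + v + y))) =
      \<psi> (- A \<omega> (v + y) - A v y) * h (\<omega> + (v + y)) * \<psi> (2 * A (v + y) u)"
    if "u \<in> L''" for u v y
  proof -
    have "\<omega> + u + v + y = \<omega> + (v + y) + u"
      by (simp add: algebra_simps)
    then have "h (\<omega> + u + v + y) = \<psi> (A (\<omega> + (v + y)) u) * h (\<omega> + (v + y))"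
      using fibreD[OF h that] by metis
    moreover have "- A \<omega> u + (- A (\<omega> + u) v + (- A (\<omega> + u + v) y + A (\<omega> + (v + y)) u)) =
        (- A \<omega> (v + y) - A v y) + 2 * A (v + y) u"
      using A_swap[of u v] A_swap[of u y]
      by (simp add: A_add_left A_add_right algebra_simps)
    ultimately show ?thesis
      by (simp add: mult_ac flip: psi_add) (simp add: mult.assoc[symmetric] add_ac flip: psi_add)
  qed
  \<comment> \<open>For \<open>v + y\<close> in \<open>L''\<close> the fibre condition yields
    \<open>\<psi> (A \<omega> (v + y))\<close>, which cancels the opposite factor in front.\<close>
  have collapse: "\<psi> (- A \<omega> (v + y) - A v y) * h (\<omega> + (v + y)) = \<psi> (- A v y) * h \<omega>"
    if "v + y \<in> L''" for v y
    using fibreD[OF h that] by (simp add: mult.assoc[symmetric] flip: psi_add)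
  have "?lhs = (\<Sum>u\<in>L''. \<Sum>v\<in>L'. \<Sum>y\<in>L.
      \<psi> (- A \<omega> (v + y) - A v y) * h (\<omega> + (v + y)) * \<psi> (2 * A (v + y) u))"
    by (simp add: sum_distrib_left move)
  also have "\<dots> = (\<Sum>v\<in>L'. \<Sum>y\<in>L. \<Sum>u\<in>L''.
      \<psi> (- A \<omega> (v + y) - A v y) * h (\<omega> + (v + y)) * \<psi> (2 * A (v + y) u))"
    by (subst sum.swap) (intro sum.cong refl sum.swap)
  \<comment> \<open>Orthogonality over \<open>L''\<close> with \<open>c = 2\<close>.\<close>
  also have "\<dots> = (\<Sum>v\<in>L'. \<Sum>y\<in>L. if v + y \<in> L''
      then \<psi> (- A \<omega> (v + y) - A v y) * h (\<omega> + (v + y)) * of_nat (card L'') else 0)"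
    by (simp add: sum_distrib_left[symmetric] sum_character_Lag[OF L(3) two_nonzero]
        if_distrib[of "\<lambda>z. _ * z"] cong: if_cong)
  also have "\<dots> = (\<Sum>v\<in>L'. \<Sum>y\<in>L. if v + y \<in> L''
      then \<psi> (- A v y) * (h \<omega> * of_nat (card L'')) else 0)"
    by (intro sum.cong refl if_cong) (simp add: collapse)
  also have "\<dots> = (\<Sum>y\<in>L. \<Sum>v\<in>L'. if v + y \<in> L''
      then \<psi> (- A v y) * (h \<omega> * of_nat (card L'')) else 0)"
    by (rule sum.swap)
  also have "\<dots> = (\<Sum>y\<in>L. \<Sum>v | v \<in> L' \<and> v + y \<in> L''. \<psi> (- A v y)) * (h \<omega> * of_nat (card L''))"
    by (simp add: sum_distrib_right sum.inter_filter if_distrib[of "\<lambda>z. z * _"] cong: if_cong)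
  finally show ?thesis
    by (simp add: sum_decompositions_Lag[OF L(2,3)] mult_ac)
qed

definition multiplier :: "'w set \<Rightarrow> 'w set \<Rightarrow> 'w set \<Rightarrow> complex" where
  "multiplier L'' L' L =
     complex_of_real (real (card (L'' \<inter> L')) powr (1 / 2) *
       (real (card (L \<inter> L'')) * real (card (L' \<inter> L)) * real (card L)) powr (- 1 / 2)) *
     gauss_sum A \<psi> L L' L''"

text \<open>Here \<open>n\<close> stands for the common cardinality of the Lagrangians and
  \<open>a\<close>, \<open>b\<close>, \<open>c\<close> for those of \<open>L' \<inter> L''\<close>,
  \<open>L \<inter> L'\<close>, \<open>L \<inter> L''\<close>. The three powers come from the three
  maps, the factor \<open>n * a\<close> from \<open>sum_triple\<close>.\<close>

lemma powr_normalization: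
  fixes n a b c :: real
  assumes "n > 0" "a > 0" "b > 0" "c > 0"
  shows "(n * a) powr (- 1 / 2) * (n * b) powr (- 1 / 2) * (n * c) powr (- 1 / 2) * (n * a) =
    a powr (1 / 2) * (c * b * n) powr (- 1 / 2)"
proof -
  have half: "x powr - (1 / 2) = 1 / sqrt x" if "x > 0" for x :: real
    using that by (simp add: powr_minus_divide powr_half_sqrt)
  have "n * a = sqrt (n * a) * sqrt (n * a)"
    using assms by simp
  then show ?thesis
    using assms by (simp add: half powr_half_sqrt real_sqrt_mult field_simps)
qed

lemma Gamma_triple:
  assumes L: "L \<in> Lag" "L' \<in> Lag" "L'' \<in> Lag" and h: "h \<in> fibre A \<psi> L''"
  shows "Gamma A \<psi> L'' L' (Gamma A \<psi> L' L (Gamma A \<psi> L L'' h)) = (\<lambda>x. multiplier L'' L' L * h x)"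
proof
  fix x
  let ?n = "real (card L)" and ?a = "real (card (L' \<inter> L''))"
    and ?b = "real (card (L \<inter> L'))" and ?c = "real (card (L \<inter> L''))"
  let ?\<kappa> = "\<lambda>t. complex_of_real ((?n * t) powr (- 1 / 2))"
  have card: "card L' = card L" "card L'' = card L"
    using L card_Lag_eq by blast+
  have "Gamma A \<psi> L'' L' (Gamma A \<psi> L' L (Gamma A \<psi> L L'' h)) x =
      ?\<kappa> ?a * ?\<kappa> ?b * ?\<kappa> ?c * (\<Sum>u\<in>L''. \<psi> (- A x u) * (\<Sum>v\<in>L'. \<psi> (- A (x + u) v) *
      (\<Sum>y\<in>L. \<psi> (- A (x + u + v) y) * h (x + u + v + y))))"
    by (simp add: Gamma_def card sum_distrib_left Int_commute mult_ac)
  also have "\<dots> = complex_of_real ((?n * ?a) powr (- 1 / 2) * (?n * ?b) powr (- 1 / 2) *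
      (?n * ?c) powr (- 1 / 2) * (?n * ?a)) * gauss_sum A \<psi> L L' L'' * h x"
    by (simp add: sum_triple[OF L h] card)
  also have "\<dots> = multiplier L'' L' L * h x"
    using L card_Lag_Int_pos[of L L]
    by (subst powr_normalization) (auto simp: multiplier_def Int_commute card_Lag_Int_pos)
  finally show "Gamma A \<psi> L'' L' (Gamma A \<psi> L' L (Gamma A \<psi> L L'' h)) x = multiplier L'' L' L * h x" .
qed

text \<open>The Gauss sum is \<open>card L\<close> here, which cancels the powers in front of
  it.\<close>

lemma multiplier_same:
  assumes "L \<in> Lag" "L' \<in> Lag"
  shows "multiplier L L' L = 1"
proof -
  let ?n = "real (card L)" and ?a = "real (card (L \<inter> L'))"
  have pos: "?n > 0" "?a > 0"
    using card_Lag_Int_pos[OF assms(1,1)] card_Lag_Int_pos[OF assms] by simp_all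
  have "a powr (1 / 2) * (n * a * n) powr (- 1 / 2) * n = 1" if "n > 0" "a > 0" for n a :: real
    using that by (simp add: powr_minus_divide powr_half_sqrt real_sqrt_mult)
  from this[OF pos] have "complex_of_real (?a powr (1 / 2) * (?n * ?a * ?n) powr (- 1 / 2)) * of_nat (card L) = 1"
    by (metis of_real_mult of_real_of_nat_eq of_real_1)
  then show ?thesis
    by (simp add: multiplier_def gauss_sum_same[OF assms] Int_commute)
qed

text \<open>\<open>Gamma_triple\<close> with \<open>L'' = L\<close>: the innermost map is the
  identity and the scalar is 1.\<close>

lemma Gamma_inverse:
  assumes "L \<in> Lag" "L' \<in> Lag" "f \<in> fibre A \<psi> L"
  shows "Gamma A \<psi> L L' (Gamma A \<psi> L' L f) = f"
  using Gamma_triple[OF assms(1,2,1,3)] by (simp add: Gamma_same multiplier_same assms)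

text \<open>\<open>Gamma_triple\<close> for the image of \<open>f\<close> in the fibre over
  \<open>L''\<close>, which the innermost map sends back to \<open>f\<close>.\<close>

lemma Gamma_comp:
  assumes "L \<in> Lag" "L' \<in> Lag" "L'' \<in> Lag" "f \<in> fibre A \<psi> L"
  shows "Gamma A \<psi> L'' L' (Gamma A \<psi> L' L f) = (\<lambda>x. multiplier L'' L' L * Gamma A \<psi> L'' L f x)"
  using Gamma_triple[OF assms(1-3) Gamma_fibre[OF assms(3)], of L f]
  by (simp add: Gamma_inverse assms)

lemma linear_iso_Gamma:
  assumes "L \<in> Lag" "L' \<in> Lag"
  shows "linear_iso_on (fibre A \<psi> L) (fibre A \<psi> L') (Gamma A \<psi> L' L)"
  unfolding linear_iso_on_def
proof (intro conjI)
  show "bij_betw (Gamma A \<psi> L' L) (fibre A \<psi> L) (fibre A \<psi> L')"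
    by (rule bij_betwI[where g = "Gamma A \<psi> L L'"])
      (auto simp: Gamma_fibre Gamma_inverse assms)
qed (simp_all add: Gamma_add Gamma_scale)

section \<open>Non-vanishing and uniqueness of the multiplier\<close>

lemma fibre_nonzero:
  assumes L: "L \<in> Lag"
  obtains f where "f \<in> fibre A \<psi> L" "f \<noteq> (\<lambda>x. 0)"
proof
  have "x + y \<in> L \<longleftrightarrow> x \<in> L" if "y \<in> L" for x y
    using that Lag_subspace[OF L] subspace_add subspace_diff[of L "x + y" y] by auto
  \<comment> \<open>The indicator function of \<open>L\<close> works: outside \<open>L\<close> both
    sides of the fibre condition are 0, and on \<open>L\<close> the form vanishes.\<close>
  then show "(\<lambda>x. of_bool (x \<in> L)) \<in> fibre A \<psi> L"
    using Lag_A_eq_0[OF L] by (auto simp: fibre_def)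
  have "(0 :: 'w) \<in> L"
    using Lag_subspace[OF L] by (rule subspace_0)
  then show "(\<lambda>x. of_bool (x \<in> L)) \<noteq> (\<lambda>x. 0 :: complex)"
    by (auto simp: fun_eq_iff)
qed

lemma Gamma_nonzero:
  assumes "L \<in> Lag" "L' \<in> Lag" "f \<in> fibre A \<psi> L" "f \<noteq> (\<lambda>x. 0)"
  shows "Gamma A \<psi> L' L f \<noteq> (\<lambda>x. 0)"
proof
  assume "Gamma A \<psi> L' L f = (\<lambda>x. 0)"
  then have "f = Gamma A \<psi> L L' (\<lambda>x. 0)"
    using Gamma_inverse[OF assms(1-3)] by simp
  also have "\<dots> = (\<lambda>x. 0)"
    by (simp add: Gamma_def)
  finally show False
    using assms(4) by simp
qed

text \<open>A zero scalar would make a composite of two injective maps kill a non-zero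
  \<open>f\<close>. In particular the Gauss sum is non-zero, without being evaluated.\<close>

lemma multiplier_nonzero:
  assumes L: "L \<in> Lag" "L' \<in> Lag" "L'' \<in> Lag"
  shows "multiplier L'' L' L \<noteq> 0"
proof
  assume "multiplier L'' L' L = 0"
  moreover obtain f where f: "f \<in> fibre A \<psi> L" "f \<noteq> (\<lambda>x. 0)"
    using fibre_nonzero[OF L(1)] .
  ultimately have "Gamma A \<psi> L'' L' (Gamma A \<psi> L' L f) = (\<lambda>x. 0)"
    by (simp add: Gamma_comp L)
  then show False
    using Gamma_nonzero[OF L(2,3) Gamma_fibre[OF L(2)] Gamma_nonzero[OF L(1,2) f]] by simp
qed

lemma is_multiplier_multiplier: "is_multiplier Lag (fibre A \<psi>) (Gamma A \<psi>) multiplier"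
  by (simp add: is_multiplier_def multiplier_nonzero Gamma_comp)

text \<open>Both scalars multiply the same non-zero function, so they agree at a point where it does
  not vanish.\<close>

lemma is_multiplier_unique:
  assumes \<mu>: "is_multiplier Lag (fibre A \<psi>) (Gamma A \<psi>) \<mu>"
    and L: "L \<in> Lag" "L' \<in> Lag" "L'' \<in> Lag"
  shows "\<mu> L'' L' L = multiplier L'' L' L"
proof -
  obtain f where f: "f \<in> fibre A \<psi> L" "f \<noteq> (\<lambda>x. 0)"
    using fibre_nonzero[OF L(1)] .
  obtain x where "Gamma A \<psi> L'' L f x \<noteq> 0"
    using Gamma_nonzero[OF L(1,3) f] by auto
  moreover have "(\<lambda>x. \<mu> L'' L' L * Gamma A \<psi> L'' L f x) = (\<lambda>x. multiplier L'' L' L * Gamma A \<psi> L'' L f x)"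
    using \<mu> L f Gamma_comp[OF L f(1)] by (simp add: is_multiplier_def)
  then have "\<mu> L'' L' L * Gamma A \<psi> L'' L f x = multiplier L'' L' L * Gamma A \<psi> L'' L f x"
    by (rule fun_cong)
  ultimately show ?thesis by simp
qed

section \<open>Connection and equivariance\<close>

lemma is_connection_Gamma: "is_connection Lag (fibre A \<psi>) (Gamma A \<psi>)"
  using is_multiplier_multiplier
  by (auto simp: is_connection_def linear_iso_Gamma Gamma_same Gamma_inverse)

lemma Gamma_equivariant:
  assumes g: "g \<in> Sp scale A"
  shows "tau_fun g (Gamma A \<psi> L' L f) = Gamma A \<psi> (tau_base g L') (tau_base g L) (tau_fun g f)"
proof
  fix x
  have bij: "bij g" and inj: "inj g" and A: "A (g u) (g v) = A u v" for u v
    using g by (auto simp: Sp_def bij_is_inj)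
  interpret g: Vector_Spaces.linear scale scale g
    using g by (simp add: Sp_def)
  define u where "u = inv g x"
  have x: "x = g u"
    using bij by (simp add: u_def bij_is_surj surj_f_inv_f)
  have card: "card (g ` L) = card L" "card (g ` L \<inter> g ` L') = card (L \<inter> L')"
    using inj by (simp_all add: image_Int[symmetric] card_image inj_on_subset)
  have "inv g (g u + g v) = u + v" for v
    using inj by (simp flip: g.add)
  moreover have "inj_on g L'"
    using inj by (rule inj_on_subset) simp
  ultimately show "tau_fun g (Gamma A \<psi> L' L f) x =
      Gamma A \<psi> (tau_base g L') (tau_base g L) (tau_fun g f) x"
    using inj by (simp add: x tau_fun_def tau_base_def Gamma_def card sum.reindex A)
qed

end

theorem mainTheorem2:
  fixes scale :: "'k::{field,finite} \<Rightarrow> 'w::ab_group_add \<Rightarrow> 'w"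
    and Basis :: "'w set"
    and A :: "'w \<Rightarrow> 'w \<Rightarrow> 'k"
    and \<psi> :: "'k \<Rightarrow> complex"
    and q m :: nat
  assumes "card (UNIV :: 'k set) = q"
    and "(2 :: 'k) \<noteq> 0"
    and "symplectic_space scale Basis A"
    and "vector_space.dim scale (UNIV :: 'w set) = 2 * m"
    and "nontrivial_character \<psi>"
  shows "is_connection (Lagrangians scale A) (fibre A \<psi>) (Gamma A \<psi>) \<and>
         is_equivariant (Sp scale A) tau_base tau_fun
           (Lagrangians scale A) (fibre A \<psi>) (Gamma A \<psi>) \<and>
         (\<forall>\<mu>. is_multiplier (Lagrangians scale A) (fibre A \<psi>) (Gamma A \<psi>) \<mu> \<longrightarrow>
           (\<forall>L\<in>Lagrangians scale A. \<forall>L'\<in>Lagrangians scale A. \<forall>L''\<in>Lagrangians scale A.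
              \<mu> L'' L' L =
                complex_of_real (real (card (L'' \<inter> L')) powr (1 / 2) *
                  (real (card (L \<inter> L'')) * real (card (L' \<inter> L)) * real (card L)) powr (- 1 / 2)) *
                gauss_sum A \<psi> L L' L''))"
proof -
  interpret symplectic_space scale Basis A
    by (rule assms(3))
  interpret finite_symplectic_space scale Basis A \<psi>
    by unfold_locales (use assms in auto)
  have "is_equivariant (Sp scale A) tau_base tau_fun Lag (fibre A \<psi>) (Gamma A \<psi>)"
    by (simp add: is_equivariant_def Gamma_equivariant)
  then show ?thesis
    using is_connection_Gamma is_multiplier_unique by (simp only: multiplier_def) blast
qed

end
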